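(* Let $b>0$ be real, let $a>0$, $x\in(0,1]$, and put $\xi=-\ln x\ge 0$. Let $I_x(a,b)$ be the normalised incomplete beta function. Let the functions $F_n=F_n(\xi,a,b)$, $n\ge 0$, be defined by $$F_0=a^{-b}Q(b,a\xi),\qquad F_1=\frac{b-a\xi}{a}F_0+\frac{\xi^b e^{-a\xi}}{a\,\Gamma(b)},$$ $$aF_{n+1}=(n+b-a\xi)F_n+n\xi F_{n-1}\qquad(n\ge 1),$$ and let the coefficients $d_n=d_n(\xi,b)$, $n\ge 0$, be defined by the Taylor expansion about $t=\xi$ $$\left(\frac{1-e^{-t}}{t}\right)^{b-1}=\sum_{n=0}^{\infty}d_n\,(t-\xi)^n .$$ Then the following hold. (i) For every fixed positive integer $N$ and every fixed positive real $b$, $$I_x(a,b)=\frac{\Gamma(a+b)}{\Gamma(a)}\left(\sum_{n=0}^{N-1}d_nF_n+\mathcal{O}\big(a^{-N}\big)F_0\right)\qquad\text{as } a\to+\infty,$$ uniformly for $x\in(0,1]$; that is, there are constants $C>0$ and $a_0>0$ depending only on $N$ and $b$ such that for all $a\ge a_0$ and all $x\in(0,1]$, $$\left|\frac{\Gamma(a)}{\Gamma(a+b)}I_x(a,b)-\sum_{n=0}^{N-1}d_nF_n\right|\le C\,a^{-N}F_0 .$$ (ii) The first two coefficients are $$d_0=\left(\frac{1-x}{\xi}\right)^{b-1},\qquad d_1=\frac{x\xi+x-1}{(1-x)\xi}\,(b-1)\,d_0,$$ where for $x=1$ (i.e. $\xi=0$) the right-hand sides are understood as their limits as $x\to1^-$.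 (iii) If $b\ne 1$, then for every integer $n\ge 0$, $$\begin{aligned}\xi(n+1)(n+2)d_0d_{n+2}={}&\xi\sum_{m=0}^{n}(m+1)\left(n-2m+1+\frac{m-n-1}{b-1}\right)d_{m+1}d_{n-m+1}\\&+\sum_{m=0}^{n}(m+1)\left(n-2m-2-\xi+\frac{m-n}{b-1}\right)d_{m+1}d_{n-m}\\&+\sum_{m=0}^{n}(1-m-b)\,d_md_{n-m}.\end{aligned}$$ (iv) If $b=1$, then $d_0=1$ and $d_n=0$ for all $n\ge1$.
   Context: For $a,b>0$ and $x\in[0,1]$, the normalised incomplete beta function is $$I_x(a,b)=\frac{1}{B(a,b)}\int_0^x t^{a-1}(1-t)^{b-1}\,dt,\qquad B(a,b)=\int_0^1 t^{a-1}(1-t)^{b-1}\,dt=\frac{\Gamma(a)\Gamma(b)}{\Gamma(a+b)}.$$ For $s>0$ and $z\ge0$, $Q(s,z)=\Gamma(s,z)/\Gamma(s)$ is the normalised upper incomplete gamma function, with $\Gamma(s,z)=\int_z^{+\infty}t^{s-1}e^{-t}\,dt$. The function $t\mapsto\frac{1-e^{-t}}{t}$ is given the value $1$ at $t=0$; it is positive for real $t$, and its power $b-1$ is the positive real power for real $t$ (a real-analytic function), so that $d_n$ is its $n$-th Taylor coefficient at $t=\xi$. *)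

theory Defs
  imports "HOL-Analysis.Analysis"
begin

text \<open>
  Intended for \<open>a, b > 0\<close> and \<open>x \<in> [0,1]\<close>. The integrands here and in the next definition
  are nonnegative, so the gauge integral agrees with the Lebesgue integral. The values of
  \<open>powr\<close> at base 0 only affect the null set of endpoints.
\<close>
definition reg_inc_beta :: "real \<Rightarrow> real \<Rightarrow> real \<Rightarrow> real" where
  "reg_inc_beta x a b =
     integral {0..x} (\<lambda>t. t powr (a - 1) * (1 - t) powr (b - 1)) / Beta a b"

definition upper_inc_Gamma :: "real \<Rightarrow> real \<Rightarrow> real" where
  "upper_inc_Gamma s z = integral {z..} (\<lambda>t. t powr (s - 1) * exp (- t))"

definition reg_upper_inc_Gamma :: "real \<Rightarrow> real \<Rightarrow> real" where
  "reg_upper_inc_Gamma s z = upper_inc_Gamma s z / Gamma s"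

text \<open>
  The last equation is \<open>a F\<^sub>k\<^sub>+\<^sub>1 = (k + b - a \<xi>) F\<^sub>k + k \<xi> F\<^sub>k\<^sub>-\<^sub>1\<close> with \<open>k = n + 1\<close>,
  solved for the leading term (\<open>a > 0\<close>).
\<close>
fun F_seq :: "real \<Rightarrow> real \<Rightarrow> real \<Rightarrow> nat \<Rightarrow> real" where
  "F_seq \<xi> a b 0 = a powr (- b) * reg_upper_inc_Gamma b (a * \<xi>)"
| "F_seq \<xi> a b (Suc 0) =
     (b - a * \<xi>) / a * F_seq \<xi> a b 0 + \<xi> powr b * exp (- a * \<xi>) / (a * Gamma b)"
| "F_seq \<xi> a b (Suc (Suc n)) =
     ((real (Suc n) + b - a * \<xi>) * F_seq \<xi> a b (Suc n) + real (Suc n) * \<xi> * F_seq \<xi> a b n) / a"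

definition exp_quot :: "real \<Rightarrow> real" where
  "exp_quot t = (if t = 0 then 1 else (1 - exp (- t)) / t)"

text \<open>The Taylor coefficients of the real-analytic function \<open>exp_quot t powr (b - 1)\<close> at \<open>\<xi>\<close>.\<close>
definition d_coeff :: "real \<Rightarrow> real \<Rightarrow> nat \<Rightarrow> real" where
  "d_coeff \<xi> b n = (deriv ^^ n) (\<lambda>t. exp_quot t powr (b - 1)) \<xi> / fact n"

end

theory Submission
  imports Defs "HOL-Complex_Analysis.Complex_Analysis"
begin

text \<open>
  Put \<open>h(t) = (1 - e\<^sup>-\<^sup>t) / t\<close>, \<open>g = h\<^sup>b\<^sup>-\<^sup>1\<close> and \<open>z = a \<xi>\<close>. Substituting \<open>t = exp (-(\<xi> + v / a))\<close> turns
  \<open>\<Gamma>(a) I\<^sub>x(a, b) / \<Gamma>(a + b)\<close> into \<open>c \<integral> (z + v)\<^sup>b\<^sup>-\<^sup>1 e\<^sup>-\<^sup>v g(\<xi> + v / a) dv\<close> over \<open>v > 0\<close>, where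
  \<open>c = e\<^sup>-\<^sup>z a\<^sup>-\<^sup>b / \<Gamma>(b)\<close>, and integration by parts identifies \<open>F\<^sub>n\<close> with
  \<open>c a\<^sup>-\<^sup>n \<integral> (z + v)\<^sup>b\<^sup>-\<^sup>1 e\<^sup>-\<^sup>v v\<^sup>n dv\<close>. The \<open>N\<close>-th derivative of \<open>g\<close> is bounded on \<open>[0, \<infinity>)\<close> for \<open>N \<ge> 1\<close>,
  so Taylor's theorem bounds the error by a multiple of \<open>F\<^sub>N\<close>. Finally \<open>F\<^sub>N = O(a\<^sup>-\<^sup>N) F\<^sub>0\<close> uniformly
  in \<open>\<xi>\<close>, because \<open>(z + v)\<^sup>b\<^sup>-\<^sup>1\<close> is comparable to \<open>(z + 1)\<^sup>b\<^sup>-\<^sup>1\<close> with constants depending on \<open>v\<close> only.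

  For the recurrence of the \<open>d\<^sub>n\<close>, the identities \<open>t h = 1 - e\<^sup>-\<^sup>t\<close> and \<open>g' h = \<beta> g h'\<close> with
  \<open>\<beta> = b - 1\<close> give \<open>t g g'' = t (1 - 1/\<beta>) g'\<^sup>2 - (2 + t) g g' - \<beta> g\<^sup>2\<close>; one compares the
  coefficients of \<open>(t - \<xi>)\<^sup>n\<close>.
\<close>

section \<open>Holomorphic extension of the powers of the exponential quotient\<close>

definition complex_exp_quot :: "complex \<Rightarrow> complex" where
  "complex_exp_quot z = (if z = 0 then 1 else (1 - exp (- z)) / z)"

text \<open>The principal logarithm of the quotient is holomorphic here. The set is open and
  contains the real line, so the power is holomorphic around every real point.\<close>

definition exp_quot_domain :: "complex set" where
  "exp_quot_domain = {z. complex_exp_quot z \<notin> \<real>\<^sub>\<le>\<^sub>0}"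

definition complex_exp_quot_power :: "real \<Rightarrow> complex \<Rightarrow> complex" where
  "complex_exp_quot_power \<beta> z = exp (of_real \<beta> * Ln (complex_exp_quot z))"

text \<open>Reading the real derivatives off the holomorphic extension provides all orders at once,
  also at t = 0. \<open>higher_deriv_exp_quot_power\<close> identifies them with the iterated real
  derivatives in \<open>d_coeff\<close>.\<close>

definition exp_quot_power_deriv :: "real \<Rightarrow> nat \<Rightarrow> real \<Rightarrow> real" where
  "exp_quot_power_deriv \<beta> n t = Re ((deriv ^^ n) (complex_exp_quot_power \<beta>) (of_real t))"

lemma mult_complex_exp_quot: "z * complex_exp_quot z = 1 - exp (- z)"
  by (simp add: complex_exp_quot_def)

text \<open>The singularity at 0 is removable: \<open>pole_theorem\<close> applies to
  \<open>1 - exp (- z)\<close>, which vanishes at 0 and has derivative 1 there.\<close>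

lemma holomorphic_complex_exp_quot: "complex_exp_quot holomorphic_on A"
proof -
  have d: "deriv (\<lambda>z::complex. 1 - exp (- z)) 0 = 1"
    by (rule DERIV_imp_deriv) (auto intro!: derivative_eq_intros)
  have "(\<lambda>z. if z = 0 then deriv (\<lambda>z::complex. 1 - exp (- z)) 0
          else ((1 - exp (- z)) / z) - (1 - exp (- 0)) / (z - 0)) holomorphic_on UNIV"
    by (rule pole_theorem) (auto intro!: holomorphic_intros)
  then have "complex_exp_quot holomorphic_on UNIV"
    unfolding d complex_exp_quot_def [abs_def] by (simp add: cong: if_cong)
  then show ?thesis by (rule holomorphic_on_subset) simp
qed

lemma open_exp_quot_domain: "open exp_quot_domain"
proof -
  have "continuous_on UNIV complex_exp_quot"
    by (intro holomorphic_on_imp_continuous_on holomorphic_complex_exp_quot)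
  then have "open (complex_exp_quot -` (- \<real>\<^sub>\<le>\<^sub>0))"
    by (intro open_vimage) auto
  moreover have "complex_exp_quot -` (- \<real>\<^sub>\<le>\<^sub>0) = exp_quot_domain"
    by (auto simp: exp_quot_domain_def)
  ultimately show ?thesis by simp
qed

lemma holomorphic_complex_exp_quot_power: "complex_exp_quot_power \<beta> holomorphic_on exp_quot_domain"
  unfolding complex_exp_quot_power_def [abs_def]
  by (intro holomorphic_intros holomorphic_complex_exp_quot) (auto simp: exp_quot_domain_def)

lemma exp_quot_pos: "exp_quot t > 0"
  by (auto simp: exp_quot_def divide_simps zero_less_divide_iff)

lemma complex_exp_quot_of_real: "complex_exp_quot (of_real t) = of_real (exp_quot t)"
  by (simp add: complex_exp_quot_def exp_quot_def exp_of_real flip: of_real_minus)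

lemma of_real_in_exp_quot_domain: "of_real t \<in> exp_quot_domain"
  using exp_quot_pos[of t]
  by (auto simp: exp_quot_domain_def complex_exp_quot_of_real complex_nonpos_Reals_iff)

lemma complex_exp_quot_power_of_real:
  "complex_exp_quot_power \<beta> (of_real t) = of_real (exp_quot t powr \<beta>)"
  using exp_quot_pos[of t]
  by (simp add: complex_exp_quot_power_def complex_exp_quot_of_real powr_def Ln_of_real
      exp_of_real flip: of_real_mult)

lemma higher_deriv_along_reals:
  "((\<lambda>t. (deriv ^^ n) (complex_exp_quot_power \<beta>) (of_real t)) has_vector_derivative
    (deriv ^^ Suc n) (complex_exp_quot_power \<beta>) (of_real t)) (at t)"
proof -
  let ?g = "(deriv ^^ n) (complex_exp_quot_power \<beta>)"
  have "?g holomorphic_on exp_quot_domain"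
    by (intro holomorphic_higher_deriv holomorphic_complex_exp_quot_power open_exp_quot_domain)
  then have "(?g has_field_derivative deriv ?g (of_real t)) (at (of_real t))"
    using holomorphic_derivI open_exp_quot_domain of_real_in_exp_quot_domain by blast
  then show ?thesis
    using has_vector_derivative_real_field by (metis comp_apply funpow.simps(2))
qed

lemma exp_quot_power_deriv_DERIV:
  "(exp_quot_power_deriv \<beta> n has_real_derivative exp_quot_power_deriv \<beta> (Suc n) t) (at t)"
  unfolding exp_quot_power_deriv_def [abs_def] has_real_derivative_iff_has_vector_derivative
  by (intro bounded_linear.has_vector_derivative [OF bounded_linear_Re] higher_deriv_along_reals)

lemma exp_quot_power_deriv_0: "exp_quot_power_deriv \<beta> 0 t = exp_quot t powr \<beta>"
  by (simp add: exp_quot_power_deriv_def complex_exp_quot_power_of_real)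

lemma higher_deriv_exp_quot_power:
  "(deriv ^^ n) (\<lambda>t. exp_quot t powr \<beta>) = exp_quot_power_deriv \<beta> n"
proof (induction n)
  case 0
  then show ?case by (auto simp: exp_quot_power_deriv_0)
next
  case (Suc n)
  have "deriv (exp_quot_power_deriv \<beta> n) = exp_quot_power_deriv \<beta> (Suc n)"
    using exp_quot_power_deriv_DERIV by (blast intro: DERIV_imp_deriv)
  then show ?case by (simp add: Suc)
qed

text \<open>Along the real line each imaginary part is the derivative of the preceding one, hence
  zero by induction. So the complex Taylor coefficients at real points are the numbers
  \<open>d_coeff\<close>.\<close>

lemma complex_higher_deriv_of_real:
  "(deriv ^^ n) (complex_exp_quot_power \<beta>) (of_real t) = of_real (exp_quot_power_deriv \<beta> n t)"
proof -
  have "Im ((deriv ^^ n) (complex_exp_quot_power \<beta>) (of_real t)) = 0"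
  proof (induction n arbitrary: t)
    case 0
    then show ?case by (simp add: complex_exp_quot_power_of_real)
  next
    case (Suc n)
    have "((\<lambda>t. Im ((deriv ^^ n) (complex_exp_quot_power \<beta>) (of_real t))) has_real_derivative
        Im ((deriv ^^ Suc n) (complex_exp_quot_power \<beta>) (of_real t))) (at t)"
      unfolding has_real_derivative_iff_has_vector_derivative
      by (intro bounded_linear.has_vector_derivative [OF bounded_linear_Im] higher_deriv_along_reals)
    then show ?case unfolding Suc using DERIV_unique DERIV_const by blast
  qed
  then show ?thesis by (simp add: exp_quot_power_deriv_def complex_eq_iff)
qed

lemma d_coeff_eq: "d_coeff \<xi> b n = exp_quot_power_deriv (b - 1) n \<xi> / fact n"
  by (simp add: d_coeff_def higher_deriv_exp_quot_power)

text \<open>This is the logarithmic derivative g'/g = \<beta> h'/h with denominators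
  cleared.\<close>

lemma complex_exp_quot_power_ODE:
  assumes "z \<in> exp_quot_domain"
  shows "deriv (complex_exp_quot_power \<beta>) z * complex_exp_quot z =
         of_real \<beta> * complex_exp_quot_power \<beta> z * deriv complex_exp_quot z"
proof -
  have z: "complex_exp_quot z \<notin> \<real>\<^sub>\<le>\<^sub>0" "complex_exp_quot z \<noteq> 0"
    using assms by (auto simp: exp_quot_domain_def)
  have [derivative_intros]: "(complex_exp_quot has_field_derivative deriv complex_exp_quot z) (at z)"
    using holomorphic_complex_exp_quot[of UNIV] by (auto intro: holomorphic_derivI)
  have "(complex_exp_quot_power \<beta> has_field_derivative
      complex_exp_quot_power \<beta> z * (of_real \<beta> * (deriv complex_exp_quot z / complex_exp_quot z))) (at z)"
    unfolding complex_exp_quot_power_def [abs_def]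
    using z by (auto intro!: derivative_eq_intros simp: field_simps)
  then show ?thesis using z by (simp add: DERIV_imp_deriv)
qed

section \<open>The recurrence of the Taylor coefficients\<close>

text \<open>The series \<open>zz\<close>, \<open>h\<close>, \<open>e\<close>, \<open>g\<close> stand
  for the expansions of t, the quotient, exp (-t) and the power. Differentiating
  \<open>zz * h = 1 - e\<close> twice eliminates h'', and differentiating the relation for g' h
  eliminates g'' h. What remains contains h' only through \<beta> g h' = g' h. The factor h cancels
  because power series over a field have no zero divisors.\<close>

lemma fps_power_ODE:
  fixes zz g h e :: "'a :: field fps"
  assumes zz: "fps_deriv zz = 1" and zh: "zz * h = 1 - e" and e: "fps_deriv e = - e"
    and gh: "fps_deriv g * h = fps_const \<beta> * g * fps_deriv h"
    and h: "h \<noteq> 0" and \<beta>: "\<beta> \<noteq> 0"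
  shows "zz * g * fps_deriv (fps_deriv g) =
         zz * fps_deriv g ^ 2 - fps_const (1 / \<beta>) * zz * fps_deriv g ^ 2
         - (2 + zz) * g * fps_deriv g - fps_const \<beta> * g ^ 2"
proof -
  let ?D = fps_deriv
  \<comment> \<open>Naming the constants turns division by \<beta> into the polynomial relation B C
    = 1, which \<open>algebra\<close> can use.\<close>
  define B C where "B = fps_const \<beta>" and "C = fps_const (1 / \<beta>)"
  have BC: "B * C = 1" using \<beta> by (simp add: B_def C_def)
  have B': "?D B = 0" by (simp add: B_def)
  have gh: "?D g * h = B * g * ?D h" using gh by (simp add: B_def)
  have 1: "zz * ?D h + h = 1 - zz * h"
  proof -
    have "zz * ?D h + h = e"
      using arg_cong[OF zh, of ?D] by (simp add: zz e)
    then show ?thesis using zh by simp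
  qed
  have 2: "zz * ?D (?D h) + 2 * ?D h = - h - zz * ?D h"
    using arg_cong[OF 1, of ?D] by (simp add: zz algebra_simps)
  have 3: "?D (?D g) * h = B * (?D g * ?D h + g * ?D (?D h)) - ?D g * ?D h"
    using arg_cong[OF gh, of ?D] by (simp add: B' algebra_simps)
  have "h * (zz * g * ?D (?D g)) = h * (zz * ?D g ^ 2 - C * zz * ?D g ^ 2
         - (2 + zz) * g * ?D g - B * g ^ 2)"
    using 2 3 gh BC by algebra
  then show ?thesis using h by (simp add: B_def C_def)
qed

lemma fps_power_recurrence:
  fixes g :: "'a :: field fps"
  defines "d \<equiv> fps_nth g"
  assumes ode: "(fps_const x + fps_X) * g * fps_deriv (fps_deriv g) =
         (fps_const x + fps_X) * fps_deriv g ^ 2 - fps_const (1 / \<beta>) * (fps_const x + fps_X) * fps_deriv g ^ 2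
         - (2 + (fps_const x + fps_X)) * g * fps_deriv g - fps_const \<beta> * g ^ 2"
    and \<beta>: "\<beta> \<noteq> 0"
  shows "x * (of_nat n + 1) * (of_nat n + 2) * d 0 * d (n + 2) =
            x * (\<Sum>m=0..n. (of_nat m + 1)
                   * (of_nat n - 2 * of_nat m + 1 + (of_nat m - of_nat n - 1) / \<beta>)
                   * d (m + 1) * d (n - m + 1))
            + (\<Sum>m=0..n. (of_nat m + 1)
                   * (of_nat n - 2 * of_nat m - 2 - x + (of_nat m - of_nat n) / \<beta>)
                   * d (m + 1) * d (n - m))
            + (\<Sum>m=0..n. (- of_nat m - \<beta>) * d m * d (n - m))"
proof -
  let ?D = fps_deriv
  define T where "T = Abs_fps (\<lambda>n. d (Suc n))"
  define B C Z where "B = fps_const \<beta>" and "C = fps_const (1 / \<beta>)" and "Z = fps_const x"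
  have gT: "g = fps_const (d 0) + fps_X * T"
  proof (rule fps_ext)
    fix k show "fps_nth g k = fps_nth (fps_const (d 0) + fps_X * T) k"
      by (cases k) (auto simp: T_def d_def)
  qed
  \<comment> \<open>Splitting \<open>g = d\<^sub>0 + X T\<close> isolates the term with \<open>d\<^sub>0 d\<^sub>n\<^sub>+\<^sub>2\<close>, and writing index factors as
    \<open>X D\<close> makes each sum of the recurrence a single coefficient without reindexing.\<close>
  have ode': "Z * fps_const (d 0) * ?D (?D g) =
    Z * (?D g * ?D g - (fps_X * ?D (?D g)) * T - C * (?D g * ?D g))
    + (?D g * (fps_X * ?D g) - (fps_X * ?D (?D g)) * g - (2 + Z) * (?D g * g) - C * (?D g * (fps_X * ?D g)))
    + (- (fps_X * ?D g) * g - B * (g * g))"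
    using ode gT unfolding B_def [symmetric] C_def [symmetric] Z_def [symmetric] by algebra
  have nX: "fps_nth (fps_X * ?D f) k = of_nat k * fps_nth f k" for f :: "'a fps" and k
    by (cases k) auto
  have nX2: "fps_nth (fps_X * ?D (?D f)) k = of_nat k * (of_nat k + 1) * fps_nth f (Suc k)"
    for f :: "'a fps" and k
    by (cases k) (auto simp: algebra_simps)
  have two: "(2 + Z) = fps_const (2 + x)"
    by (simp add: Z_def flip: fps_const_add fps_numeral_fps_const)
  have 1: "fps_nth (?D g * ?D g - (fps_X * ?D (?D g)) * T - C * (?D g * ?D g)) n =
      (\<Sum>m=0..n. (of_nat m + 1)
                   * (of_nat n - 2 * of_nat m + 1 + (of_nat m - of_nat n - 1) / \<beta>)
                   * d (m + 1) * d (n - m + 1))"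
    unfolding C_def fps_sub_nth fps_mult_left_const_nth fps_mult_nth[of "?D g"]
      fps_mult_nth[of "fps_X * _"] sum_distrib_left sum_subtractf [symmetric]
  proof (rule sum.cong, goal_cases)
    case (2 m)
    \<comment> \<open>Writing n = m + k removes the truncated subtraction n - m.\<close>
    then obtain k where "n = m + k" by (auto dest: le_Suc_ex)
    then show ?case using \<beta> by (simp add: nX2 T_def d_def field_simps)
  qed simp
  have 2: "fps_nth (?D g * (fps_X * ?D g) - (fps_X * ?D (?D g)) * g - (2 + Z) * (?D g * g)
        - C * (?D g * (fps_X * ?D g))) n =
      (\<Sum>m=0..n. (of_nat m + 1)
                   * (of_nat n - 2 * of_nat m - 2 - x + (of_nat m - of_nat n) / \<beta>)
                   * d (m + 1) * d (n - m))"
    unfolding C_def two fps_sub_nth fps_mult_left_const_nth fps_mult_nth[of "?D g"]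
      fps_mult_nth[of "fps_X * _"] sum_distrib_left sum_subtractf [symmetric]
  proof (rule sum.cong, goal_cases)
    case (2 m)
    then obtain k where "n = m + k" by (auto dest: le_Suc_ex)
    then show ?case using \<beta> by (simp add: nX nX2 d_def field_simps)
  qed simp
  have 3: "fps_nth (- (fps_X * ?D g) * g - B * (g * g)) n = 
     (\<Sum>m=0..n. (- of_nat m - \<beta>) * d m * d (n - m))"
    unfolding B_def mult_minus_left fps_sub_nth fps_neg_nth fps_mult_left_const_nth fps_mult_nth[of "fps_X * _"]
      fps_mult_nth[of g] sum_distrib_left sum_negf [symmetric] sum_subtractf [symmetric]
    by (rule sum.cong) (auto simp: nX d_def algebra_simps)
  have "fps_nth (Z * fps_const (d 0) * ?D (?D g)) n = x * (of_nat n + 1) * (of_nat n + 2) * d 0 * d (n + 2)"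
    by (simp add: Z_def d_def algebra_simps mult.assoc)
  moreover have "fps_nth (Z * P) n = x * fps_nth P n" for P by (simp add: Z_def)
  ultimately show ?thesis
    using arg_cong[OF ode', of "\<lambda>f. fps_nth f n"] 1 2 3 by (simp only: fps_add_nth)
qed

text \<open>Uniqueness of complex power series expansions about \<xi> turns the functional
  identities into identities of formal series, to which the two preceding lemmas apply. The point
  \<xi> = 0 needs no separate treatment.\<close>

lemma d_coeff_recurrence:
  fixes b \<xi> :: real and n :: nat
  defines "d \<equiv> d_coeff \<xi> b"
  assumes b: "b \<noteq> 1"
  shows "\<xi> * (real n + 1) * (real n + 2) * d 0 * d (n + 2) =
            \<xi> * (\<Sum>m=0..n. (real m + 1)
                   * (real n - 2 * real m + 1 + (real m - real n - 1) / (b - 1))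
                   * d (m + 1) * d (n - m + 1))
            + (\<Sum>m=0..n. (real m + 1)
                   * (real n - 2 * real m - 2 - \<xi> + (real m - real n) / (b - 1))
                   * d (m + 1) * d (n - m))
            + (\<Sum>m=0..n. (1 - real m - b) * d m * d (n - m))"
proof -
  define \<beta> where "\<beta> = b - 1"
  have \<beta>: "\<beta> \<noteq> 0" using b by (simp add: \<beta>_def)
  let ?x = "complex_of_real \<xi>"
  define G H where "G = complex_exp_quot_power \<beta>" and "H = complex_exp_quot"
  define g h where "g = fps_expansion G ?x" and "h = fps_expansion H ?x"
  define e where "e = fps_const (exp (- ?x)) * fps_exp (-1)"
  define zz where "zz = fps_const ?x + fps_X"
  have anG: "G analytic_on {?x}"
    unfolding G_def using holomorphic_complex_exp_quot_power open_exp_quot_domain of_real_in_exp_quot_domain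
    by (auto simp: analytic_at)
  have anH: "H analytic_on {?x}"
    unfolding H_def using holomorphic_complex_exp_quot open_UNIV
    by (auto simp: analytic_at)
  have g: "(\<lambda>w. G (?x + w)) has_fps_expansion g" and h: "(\<lambda>w. H (?x + w)) has_fps_expansion h"
    unfolding g_def h_def by (intro analytic_at_imp_has_fps_expansion anG anH)+
  have shift: "deriv (\<lambda>w. f (?x + w)) = (\<lambda>w. deriv f (?x + w))" for f :: "complex \<Rightarrow> complex"
    unfolding fun_eq_iff deriv_def using DERIV_shift [of f _ _ ?x] by (simp add: add.commute [of ?x])
  have g': "(\<lambda>w. deriv G (?x + w)) has_fps_expansion fps_deriv g"
    and h': "(\<lambda>w. deriv H (?x + w)) has_fps_expansion fps_deriv h"
    using has_fps_expansion_deriv[OF g] has_fps_expansion_deriv[OF h] by (simp_all add: shift)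
  have zz: "(\<lambda>w. ?x + w) has_fps_expansion zz"
    unfolding zz_def by (intro fps_expansion_intros)
  have "(\<lambda>w. exp (- ?x) * exp (-1 * w)) has_fps_expansion e"
    unfolding e_def by (intro fps_expansion_intros)
  then have e: "(\<lambda>w. exp (- (?x + w))) has_fps_expansion e"
    by (simp add: exp_diff exp_minus field_simps exp_add)
  have "zz * h = 1 - e"
  proof (rule fps_expansion_unique_complex)
    show "(\<lambda>w. (?x + w) * H (?x + w)) has_fps_expansion zz * h"
      by (intro fps_expansion_intros zz h)
    show "(\<lambda>w. (?x + w) * H (?x + w)) has_fps_expansion 1 - e"
      unfolding H_def mult_complex_exp_quot by (intro fps_expansion_intros e)
  qed
  moreover have "fps_deriv g * h = fps_const (of_real \<beta>) * g * fps_deriv h"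
  proof (rule fps_expansion_unique_complex)
    show "(\<lambda>w. deriv G (?x + w) * H (?x + w)) has_fps_expansion fps_deriv g * h"
      by (intro fps_expansion_intros g' h)
    have 1: "(\<lambda>w. of_real \<beta> * G (?x + w) * deriv H (?x + w)) has_fps_expansion
        fps_const (of_real \<beta>) * g * fps_deriv h"
      by (intro fps_expansion_intros g h')
    \<comment> \<open>The differential relation is available on \<open>exp_quot_domain\<close>. That
      suffices, since an expansion depends only on values near 0.\<close>
    have "open ((\<lambda>w. ?x + w) -` exp_quot_domain)"
      by (intro open_vimage open_exp_quot_domain continuous_intros)
    then have "\<forall>\<^sub>F w in nhds 0. w \<in> (\<lambda>w. ?x + w) -` exp_quot_domain"
      by (rule eventually_nhds_in_open) (use of_real_in_exp_quot_domain in auto)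
    then have "\<forall>\<^sub>F w in nhds 0. of_real \<beta> * G (?x + w) * deriv H (?x + w) = deriv G (?x + w) * H (?x + w)"
      by (auto elim!: eventually_mono simp: G_def H_def complex_exp_quot_power_ODE)
    then show "(\<lambda>w. deriv G (?x + w) * H (?x + w)) has_fps_expansion
        fps_const (of_real \<beta>) * g * fps_deriv h"
      using 1 by (subst (asm) has_fps_expansion_cong) auto
  qed
  \<comment> \<open>The constant coefficient is positive even for \<xi> = 0, which permits the
    cancellation of h.\<close>
  moreover have "fps_nth h 0 = of_real (exp_quot \<xi>)"
    by (simp add: h_def fps_expansion_def H_def complex_exp_quot_of_real)
  then have "h \<noteq> 0" using exp_quot_pos[of \<xi>] by auto
  moreover have "fps_deriv zz = 1" "fps_deriv e = - e"
    by (simp_all add: zz_def e_def flip: fps_const_neg)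
  ultimately have ode: "zz * g * fps_deriv (fps_deriv g) =
         zz * fps_deriv g ^ 2 - fps_const (1 / of_real \<beta>) * zz * fps_deriv g ^ 2
         - (2 + zz) * g * fps_deriv g - fps_const (of_real \<beta>) * g ^ 2"
    using \<beta> by (intro fps_power_ODE) auto
  have d: "fps_nth g k = of_real (d k)" for k
    by (simp add: g_def fps_expansion_def G_def complex_higher_deriv_of_real d_def d_coeff_eq \<beta>_def)
  have b1: "1 - real m - b = - real m - \<beta>" for m by (simp add: \<beta>_def)
  have "complex_of_real (\<xi> * (real n + 1) * (real n + 2) * d 0 * d (n + 2)) =
    of_real (\<xi> * (\<Sum>m=0..n. (real m + 1)
                   * (real n - 2 * real m + 1 + (real m - real n - 1) / \<beta>)
                   * d (m + 1) * d (n - m + 1))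
            + (\<Sum>m=0..n. (real m + 1)
                   * (real n - 2 * real m - 2 - \<xi> + (real m - real n) / \<beta>)
                   * d (m + 1) * d (n - m))
            + (\<Sum>m=0..n. (- real m - \<beta>) * d m * d (n - m)))"
    using fps_power_recurrence [OF ode [unfolded zz_def], of n, unfolded d] \<beta>
    by simp
  then show ?thesis
    unfolding b1 \<beta>_def [symmetric] of_real_eq_iff .
qed

section \<open>Low-order coefficients and bounds for the derivatives\<close>

lemma d_coeff_0: "d_coeff \<xi> b 0 = exp_quot \<xi> powr (b - 1)"
  by (simp add: d_coeff_eq exp_quot_power_deriv_0)

lemma d_coeff_1:
  assumes "\<xi> \<noteq> 0"
  shows "d_coeff \<xi> b 1 = (\<xi> * exp (- \<xi>) + exp (- \<xi>) - 1) / ((1 - exp (- \<xi>)) * \<xi>) * (b - 1) * d_coeff \<xi> b 0"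
proof -
  let ?h' = "(\<xi> * exp (- \<xi>) - (1 - exp (- \<xi>))) / \<xi>\<^sup>2"
  have "((\<lambda>t. (1 - exp (- t)) / t) has_real_derivative ?h') (at \<xi>)"
    using assms by (auto intro!: derivative_eq_intros simp: power2_eq_square)
  then have h': "(exp_quot has_real_derivative ?h') (at \<xi>)"
    by (rule has_field_derivative_transform_within_open [of _ _ _ "- {0}"])
      (use assms in \<open>auto simp: exp_quot_def\<close>)
  have "((\<lambda>t. exp_quot t powr (b - 1)) has_real_derivative
      (b - 1) * exp_quot \<xi> powr (b - 1) * (?h' / exp_quot \<xi>)) (at \<xi>)"
    by (rule DERIV_cong [OF DERIV_fun_powr [OF h' exp_quot_pos]])
      (use exp_quot_pos [of \<xi>] in \<open>simp add: powr_diff field_simps power2_eq_square\<close>)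
  moreover have "exp_quot_power_deriv (b - 1) 0 = (\<lambda>t. exp_quot t powr (b - 1))"
    by (auto simp: exp_quot_power_deriv_0)
  ultimately have "exp_quot_power_deriv (b - 1) 1 \<xi> = (b - 1) * exp_quot \<xi> powr (b - 1) * (?h' / exp_quot \<xi>)"
    using exp_quot_power_deriv_DERIV [of "b - 1" 0 \<xi>] by (metis DERIV_unique One_nat_def)
  moreover have "?h' / exp_quot \<xi> = (\<xi> * exp (- \<xi>) + exp (- \<xi>) - 1) / ((1 - exp (- \<xi>)) * \<xi>)"
    using assms exp_quot_pos [of \<xi>] by (simp add: exp_quot_def power2_eq_square) (simp add: diff_diff_eq2 mult.commute)
  ultimately have *: "exp_quot_power_deriv (b - 1) 1 \<xi> = (b - 1) * exp_quot \<xi> powr (b - 1) *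
      ((\<xi> * exp (- \<xi>) + exp (- \<xi>) - 1) / ((1 - exp (- \<xi>)) * \<xi>))"
    by (simp only:)
  show ?thesis
    unfolding d_coeff_0 d_coeff_eq [of \<xi> b 1] * by simp
qed

lemma isCont_d_coeff: "isCont (\<lambda>\<xi>. d_coeff \<xi> b n) \<xi>"
  unfolding d_coeff_eq by (intro continuous_intros DERIV_isCont [OF exp_quot_power_deriv_DERIV]) simp

text \<open>Continuity of the coefficients in \<xi> gives the limits at x = 1 without expanding the
  closed forms there.\<close>

lemma d_coeff_tendsto_at_left_1: "((\<lambda>x. d_coeff (- ln x) b n) \<longlongrightarrow> d_coeff 0 b n) (at_left 1)"
proof -
  have "((\<lambda>x::real. - ln x) \<longlongrightarrow> 0) (at_left 1)"
    by (auto intro!: tendsto_eq_intros)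
  then show ?thesis by (rule isCont_tendsto_compose [OF isCont_d_coeff])
qed

lemma d_coeff_at_1: "d_coeff \<xi> 1 n = (if n = 0 then 1 else 0)"
proof -
  have "(\<lambda>t. exp_quot t powr 0) = (\<lambda>t. 1)"
    using exp_quot_pos by (auto simp: fun_eq_iff less_imp_neq [symmetric])
  moreover have "(deriv ^^ n) (\<lambda>t::real. 1::real) = (\<lambda>t. if n = 0 then 1 else 0)"
    by (induction n) auto
  ultimately show ?thesis by (simp add: d_coeff_def)
qed

section \<open>Growth of the derivatives at infinity\<close>

text \<open>
  Finite sums of \<open>s\<^sup>\<alpha> (1 - e\<^sup>-\<^sup>s)\<^sup>\<beta> e\<^sup>-\<^sup>k\<^sup>s\<close> of growth order \<open>p\<close> at infinity: the terms with \<open>k > 0\<close> decay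
  exponentially, so only those with \<open>k = 0\<close> are constrained. Differentiation lowers \<open>p\<close> by one.
\<close>
inductive tame :: "real \<Rightarrow> (real \<Rightarrow> real) \<Rightarrow> bool" where
  basic: "(k = 0 \<Longrightarrow> \<alpha> \<le> p) \<Longrightarrow> tame p (\<lambda>s. s powr \<alpha> * (1 - exp (- s)) powr \<beta> * exp (- s) ^ k)"
| add: "tame p f \<Longrightarrow> tame p g \<Longrightarrow> tame p (\<lambda>s. f s + g s)"
| scale: "tame p f \<Longrightarrow> tame p (\<lambda>s. c * f s)"

text \<open>Differentiating the power of s lowers \<alpha> by one. The other two terms of the
  product rule carry a factor exp (-s), so their power of s is unconstrained.\<close>

lemma tame_deriv:
  assumes "tame p f"
  shows "\<exists>f'. tame (p - 1) f' \<and> (\<forall>s>0. (f has_real_derivative f' s) (at s))"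
  using assms
proof induction
  case (basic k \<alpha> p \<beta>)
  \<comment> \<open>For k = 0 the last term has coefficient 0 but must still be tame of order p - 1;
    the exponent \<open>max k 1\<close> keeps it among the exponentially decaying terms.\<close>
  define f' where "f' = (\<lambda>s::real. \<alpha> * (s powr (\<alpha> - 1) * (1 - exp (- s)) powr \<beta> * exp (- s) ^ k)
      + (\<beta> * (s powr \<alpha> * (1 - exp (- s)) powr (\<beta> - 1) * exp (- s) ^ Suc k)
        + (- real k) * (s powr \<alpha> * (1 - exp (- s)) powr \<beta> * exp (- s) ^ (max k 1))))"
  have "tame (p - 1) f'"
    unfolding f'_def by (intro tame.intros) (use basic in auto)
  moreover have "((\<lambda>s. s powr \<alpha> * (1 - exp (- s)) powr \<beta> * exp (- s) ^ k) has_real_derivative f' s) (at s)"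
    if "s > 0" for s
  proof -
    have s: "1 - exp (- s) > 0" using that by simp
    have E: "((\<lambda>s. exp (- s) ^ k) has_real_derivative - real k * exp (- s) ^ max k 1) (at s)"
    proof (cases k)
      case (Suc j)
      have "((\<lambda>s. exp (- s)) has_real_derivative - exp (- s)) (at s)"
        by (auto intro!: derivative_eq_intros)
      from DERIV_power [OF this, of k] show ?thesis
        by (rule DERIV_cong) (simp add: Suc algebra_simps)
    qed simp
    have Q: "((\<lambda>s. 1 - exp (- s)) has_real_derivative exp (- s)) (at s)"
      by (auto intro!: derivative_eq_intros)
    have P: "((\<lambda>s. s powr \<alpha>) has_real_derivative \<alpha> * s powr (\<alpha> - 1)) (at s)"
      using that by (rule has_real_derivative_powr)
    show ?thesis
      by (rule DERIV_cong [OF DERIV_mult [OF DERIV_mult [OF P DERIV_fun_powr [OF Q s]] E]])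
        (simp add: f'_def algebra_simps)
  qed
  ultimately show ?case by blast
next
  case (add p f g)
  then obtain f' g' where "tame (p - 1) f'" "tame (p - 1) g'"
    "\<forall>s>0. (f has_real_derivative f' s) (at s)" "\<forall>s>0. (g has_real_derivative g' s) (at s)"
    by blast
  then show ?case
    by (intro exI [of _ "\<lambda>s. f' s + g' s"]) (auto intro!: tame.intros derivative_intros)
next
  case (scale p f c)
  then obtain f' where "tame (p - 1) f'" "\<forall>s>0. (f has_real_derivative f' s) (at s)"
    by blast
  then show ?case
    by (intro exI [of _ "\<lambda>s. c * f' s"]) (auto intro!: tame.intros DERIV_cmult)
qed

text \<open>Raise y \<le> exp y at y = s / \<alpha> to the power \<alpha>.\<close>

lemma powr_le_const_mult_exp:
  fixes s \<alpha> :: real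
  assumes "s > 0" "\<alpha> > 0"
  shows "s powr \<alpha> \<le> \<alpha> powr \<alpha> * exp s"
proof -
  have "s / \<alpha> \<le> exp (s / \<alpha>)" using exp_ge_add_one_self [of "s / \<alpha>"] by linarith
  then have "(s / \<alpha>) powr \<alpha> \<le> exp (s / \<alpha>) powr \<alpha>" using assms by (intro powr_mono2) auto
  also have "\<dots> = exp s" using assms by (simp add: powr_def)
  finally show ?thesis using assms by (simp add: powr_divide field_simps)
qed

lemma tame_bounded:
  assumes "tame p f" "p \<le> 0"
  shows "\<exists>M. \<forall>s\<ge>1. \<bar>f s\<bar> \<le> M"
  using assms
proof induction
  case (basic k \<alpha> p \<beta>)
  have "continuous_on {1 - exp (- 1)..1} (\<lambda>y::real. y powr \<beta>)"
    by (intro continuous_intros) auto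
  then have "compact ((\<lambda>y::real. y powr \<beta>) ` {1 - exp (- 1)..1})"
    by (rule compact_continuous_image) simp
  then obtain A where A: "\<And>y::real. y \<in> {1 - exp (- 1)..1} \<Longrightarrow> \<bar>y powr \<beta>\<bar> \<le> A"
    using compact_imp_bounded bounded_iff by (metis imageI real_norm_def)
  obtain B where B: "\<And>s::real. s \<ge> 1 \<Longrightarrow> s powr \<alpha> * exp (- s) ^ k \<le> B"
  proof (cases k)
    case 0
    show ?thesis
    proof (rule that [of 1])
      fix s :: real assume "s \<ge> 1"
      then have "s powr \<alpha> \<le> s powr 0" using basic 0 by (intro powr_mono) auto
      then show "s powr \<alpha> * exp (- s) ^ k \<le> 1" using 0 \<open>s \<ge> 1\<close> by simp
    qed
  next
    case (Suc j)
    \<comment> \<open>The exponent is raised to at least 1 because the comparison with the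
      exponential asks for a positive one.\<close>
    define \<gamma> where "\<gamma> = max \<alpha> 1"
    show ?thesis
    proof (rule that [of "\<gamma> powr \<gamma>"])
      fix s :: real assume s: "s \<ge> 1"
      have "exp (- s) ^ k \<le> exp (- s)"
        using power_decreasing [of 1 k "exp (- s)"] s Suc by simp
      moreover have "s powr \<alpha> \<le> s powr \<gamma>" using s by (intro powr_mono) (auto simp: \<gamma>_def)
      ultimately have "s powr \<alpha> * exp (- s) ^ k \<le> s powr \<gamma> * exp (- s)"
        by (intro mult_mono) auto
      also have "\<dots> \<le> \<gamma> powr \<gamma> * exp s * exp (- s)"
        using s by (intro mult_right_mono powr_le_const_mult_exp) (auto simp: \<gamma>_def)
      finally show "s powr \<alpha> * exp (- s) ^ k \<le> \<gamma> powr \<gamma>" by (simp add: mult.assoc flip: exp_add)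
    qed
  qed
  show ?case
  proof (intro exI allI impI)
    fix s :: real assume s: "s \<ge> 1"
    have "\<bar>s powr \<alpha> * (1 - exp (- s)) powr \<beta> * exp (- s) ^ k\<bar> =
      (s powr \<alpha> * exp (- s) ^ k) * \<bar>(1 - exp (- s)) powr \<beta>\<bar>"
      by (simp add: abs_mult)
    also have "\<dots> \<le> B * A"
      using s order_trans [OF _ B [of 1]] by (intro mult_mono A B) auto
    finally show "\<bar>s powr \<alpha> * (1 - exp (- s)) powr \<beta> * exp (- s) ^ k\<bar> \<le> B * A" .
  qed
next
  case (add p f g)
  then obtain M N where "\<forall>s\<ge>1. \<bar>f s\<bar> \<le> M" "\<forall>s\<ge>1. \<bar>g s\<bar> \<le> N" by blast
  then have "\<bar>f s + g s\<bar> \<le> M + N" if "s \<ge> 1" for s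
    using that abs_triangle_ineq [of "f s" "g s"] by (metis add_mono order_trans)
  then show ?case by blast
next
  case (scale p f c)
  then obtain M where "\<forall>s\<ge>1. \<bar>f s\<bar> \<le> M" by blast
  then have "\<bar>c * f s\<bar> \<le> \<bar>c\<bar> * M" if "s \<ge> 1" for s
    using that by (simp add: abs_mult mult_left_mono)
  then show ?case by blast
qed

text \<open>The quotient behaves like 1/s at infinity, so its power starts with order -\<beta>, and
  each derivative lowers the order by one.\<close>

lemma exp_quot_power_deriv_tame:
  "\<exists>f. tame (- \<beta> - real n) f \<and> (\<forall>s>0. exp_quot_power_deriv \<beta> n s = f s)"
proof (induction n)
  case 0
  have "tame (- \<beta>) (\<lambda>s. s powr (- \<beta>) * (1 - exp (- s)) powr \<beta> * exp (- s) ^ 0)"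
    by (rule tame.basic) simp
  moreover have "exp_quot_power_deriv \<beta> 0 s = s powr (- \<beta>) * (1 - exp (- s)) powr \<beta> * exp (- s) ^ 0"
    if "s > 0" for s
    using that by (simp add: exp_quot_power_deriv_0 exp_quot_def powr_divide powr_minus field_simps)
  ultimately show ?case by (intro exI conjI allI impI) auto
next
  case (Suc n)
  then obtain f where f: "tame (- \<beta> - real n) f" "\<And>s. s > 0 \<Longrightarrow> exp_quot_power_deriv \<beta> n s = f s"
    by blast
  obtain f' where f': "tame (- \<beta> - real n - 1) f'" "\<And>s. s > 0 \<Longrightarrow> (f has_real_derivative f' s) (at s)"
    using tame_deriv [OF f(1)] by blast
  have "exp_quot_power_deriv \<beta> (Suc n) s = f' s" if "s > 0" for s
  proof -
    have "(exp_quot_power_deriv \<beta> n has_real_derivative f' s) (at s)"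
      by (rule has_field_derivative_transform_within_open [OF f'(2), of _ "{0<..}"])
        (use that f(2) in auto)
    then show ?thesis using DERIV_unique exp_quot_power_deriv_DERIV by blast
  qed
  then show ?case using f'(1) by (intro exI [of _ f']) (auto simp: algebra_simps)
qed

text \<open>
  Since \<open>b > 0\<close>, this applies to \<open>\<beta> = b - 1\<close> for every \<open>n \<ge> 1\<close>, which is what makes the
  expansion uniform in \<open>\<xi>\<close>.
\<close>
lemma exp_quot_power_deriv_bounded:
  assumes "- \<beta> \<le> real n"
  shows "\<exists>M\<ge>0. \<forall>s\<ge>0. \<bar>exp_quot_power_deriv \<beta> n s\<bar> \<le> M"
proof -
  obtain M1 where M1: "\<And>s. s \<ge> 1 \<Longrightarrow> \<bar>exp_quot_power_deriv \<beta> n s\<bar> \<le> M1"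
  proof -
    obtain f where f: "tame (- \<beta> - real n) f" "\<And>s. s > 0 \<Longrightarrow> exp_quot_power_deriv \<beta> n s = f s"
      using exp_quot_power_deriv_tame by blast
    obtain M where "\<And>s. s \<ge> 1 \<Longrightarrow> \<bar>f s\<bar> \<le> M"
      using tame_bounded [OF f(1)] assms by auto
    then show ?thesis using that [of M] f(2) by auto
  qed
  \<comment> \<open>Single tame terms may blow up at 0, so on [0, 1] the bound comes from continuity
    of the derivative instead.\<close>
  have "compact (exp_quot_power_deriv \<beta> n ` {0..1})"
    by (intro compact_continuous_image continuous_at_imp_continuous_on ballI
        DERIV_isCont [OF exp_quot_power_deriv_DERIV]) simp
  then obtain M0 where M0: "\<And>s. s \<in> {0..1} \<Longrightarrow> \<bar>exp_quot_power_deriv \<beta> n s\<bar> \<le> M0"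
    using compact_imp_bounded bounded_iff by (metis imageI real_norm_def)
  show ?thesis
  proof (intro exI conjI allI impI)
    show "0 \<le> max M0 M1" using M0 [of 0] by auto
    fix s :: real assume "s \<ge> 0"
    then show "\<bar>exp_quot_power_deriv \<beta> n s\<bar> \<le> max M0 M1"
      using M0 [of s] M1 [of s] by (cases "s \<le> 1") auto
  qed
qed

text \<open>Lagrange's remainder is evaluated at some t > \<xi> \<ge> 0. The bound on the N-th
  derivative over the whole half-line makes M independent of \<xi>.\<close>

lemma exp_quot_power_Taylor_bound:
  assumes "b > 0" "N > 0"
  shows "\<exists>M\<ge>0. \<forall>\<xi>\<ge>0. \<forall>u>0.
    \<bar>exp_quot (\<xi> + u) powr (b - 1) - (\<Sum>n<N. d_coeff \<xi> b n * u ^ n)\<bar> \<le> M * u ^ N"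
proof -
  obtain M where M: "M \<ge> 0" "\<And>s. s \<ge> 0 \<Longrightarrow> \<bar>exp_quot_power_deriv (b - 1) N s\<bar> \<le> M"
    using exp_quot_power_deriv_bounded [of "b - 1" N] assms by auto
  show ?thesis
  proof (intro exI conjI allI impI)
    show "M / fact N \<ge> 0" using M by simp
    fix \<xi> u :: real assume \<xi>: "\<xi> \<ge> 0" and u: "u > 0"
    have "\<exists>t. \<xi> < t \<and> t < \<xi> + u \<and> exp_quot_power_deriv (b - 1) 0 (\<xi> + u) =
      (\<Sum>m<N. exp_quot_power_deriv (b - 1) m \<xi> / fact m * (\<xi> + u - \<xi>) ^ m)
      + exp_quot_power_deriv (b - 1) N t / fact N * (\<xi> + u - \<xi>) ^ N"
      by (rule Taylor_up [where a = \<xi>]) (use assms u exp_quot_power_deriv_DERIV in auto)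
    then obtain t where t: "\<xi> < t"
      "exp_quot_power_deriv (b - 1) 0 (\<xi> + u) =
        (\<Sum>m<N. exp_quot_power_deriv (b - 1) m \<xi> / fact m * (\<xi> + u - \<xi>) ^ m)
        + exp_quot_power_deriv (b - 1) N t / fact N * (\<xi> + u - \<xi>) ^ N"
      by blast
    then have "exp_quot (\<xi> + u) powr (b - 1) - (\<Sum>n<N. d_coeff \<xi> b n * u ^ n) =
        exp_quot_power_deriv (b - 1) N t / fact N * u ^ N"
      by (simp add: exp_quot_power_deriv_0 d_coeff_eq)
    then show "\<bar>exp_quot (\<xi> + u) powr (b - 1) - (\<Sum>n<N. d_coeff \<xi> b n * u ^ n)\<bar> \<le> M / fact N * u ^ N"
      using M(2) [of t] t(1) \<xi> u by (simp add: abs_mult mult_right_mono divide_right_mono)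
  qed
qed

section \<open>Shifted gamma integrals\<close>

text \<open>For n = 0 this is exp z times the upper incomplete gamma function at z. For z > 0 it is
  n! z^(n+b) U(n+1, n+b+1, z) with Tricomi's function U.\<close>

definition shifted_gamma_integral :: "real \<Rightarrow> real \<Rightarrow> nat \<Rightarrow> real" where
  "shifted_gamma_integral b z n = integral {0<..} (\<lambda>v. (z + v) powr (b - 1) * exp (- v) * v ^ n)"

text \<open>The number z + v lies between z + 1 and (z + 1) v, so its power is at most the larger of
  their powers, whatever the sign of \<beta>.\<close>

lemma shifted_powr_le:
  fixes z v \<beta> :: real
  assumes z: "z \<ge> 0" and v: "v > 0"
  shows "(z + v) powr \<beta> \<le> (z + 1) powr \<beta> * (1 + v powr \<beta>)"
proof -
  have *: "(z + 1) powr \<beta> * (1 + v powr \<beta>) = (z + 1) powr \<beta> + ((z + 1) * v) powr \<beta>"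
    by (subst powr_mult) (use assms in \<open>auto simp: algebra_simps\<close>)
  have zv: "z * v \<le> z" if "v \<le> 1" using z that by (simp add: mult_left_le)
  have zv': "z \<le> z * v" if "v \<ge> 1" using z that by (simp add: mult_le_cancel_left1)
  have "(z + v) powr \<beta> \<le> (z + 1) powr \<beta> \<or> (z + v) powr \<beta> \<le> ((z + 1) * v) powr \<beta>"
  proof (cases "\<beta> \<ge> 0")
    case True
    then show ?thesis using assms zv'
      by (cases "v \<le> 1") (auto intro!: powr_mono2 simp: algebra_simps)
  next
    case False
    then show ?thesis using assms zv
      by (cases "v \<le> 1") (auto intro!: powr_mono2' simp: algebra_simps add_pos_nonneg)
  qed
  then show ?thesis unfolding * by (smt (verit) powr_ge_zero)
qed

lemma Gamma_integral_pow:
  assumes "x > (0::real)"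
  shows "((\<lambda>t. t powr (x - 1) * exp (- t)) has_integral Gamma x) {0<..}"
proof -
  have "((\<lambda>t. t powr (x - 1) / exp t) has_integral Gamma x) {0..}"
    by (rule Gamma_integral_real [OF assms])
  then have "((\<lambda>t. t powr (x - 1) / exp t) has_integral Gamma x) {0<..}"
    by (subst has_integral_spike_set_eq [of _ "{0..}"])
      (auto intro!: negligible_subset [OF negligible_sing [of "0::real"]])
  then show ?thesis by (simp add: exp_minus divide_inverse)
qed

lemma shifted_gamma_absolutely_integrable:
  assumes b: "b > 0" and z: "z \<ge> 0"
  shows "(\<lambda>v. (z + v) powr (b - 1) * exp (- v) * v ^ n) absolutely_integrable_on {0<..}"
    and "shifted_gamma_integral b z n \<le> (z + 1) powr (b - 1) * (Gamma (real n + 1) + Gamma (real n + b))"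
proof -
  let ?f = "\<lambda>v. (z + v) powr (b - 1) * exp (- v) * v ^ n"
  let ?g = "\<lambda>v. (z + 1) powr (b - 1) * (v powr ((real n + 1) - 1) * exp (- v) + v powr ((real n + b) - 1) * exp (- v))"
  have I: "(?g has_integral (z + 1) powr (b - 1) * (Gamma (real n + 1) + Gamma (real n + b))) {0<..}"
    using b by (intro has_integral_mult_right has_integral_add Gamma_integral_pow) auto
  have le: "norm (?f v) \<le> ?g v" if "v \<in> {0<..}" for v
  proof -
    have v: "v > 0" using that by simp
    have p: "v powr ((real n + 1) - 1) = v ^ n" "v powr ((real n + b) - 1) = v powr (b - 1) * v ^ n"
      using v by (simp_all add: powr_realpow powr_add powr_diff)
    have "norm (?f v) = (z + v) powr (b - 1) * (exp (- v) * v ^ n)"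
      using v by (simp add: abs_mult)
    also have "\<dots> \<le> (z + 1) powr (b - 1) * (1 + v powr (b - 1)) * (exp (- v) * v ^ n)"
      using shifted_powr_le [OF z v] v by (intro mult_right_mono) auto
    also have "\<dots> = ?g v" unfolding p by (simp add: algebra_simps)
    finally show ?thesis .
  qed
  show abs: "?f absolutely_integrable_on {0<..}"
  proof (rule measurable_bounded_by_integrable_imp_absolutely_integrable [OF _ _ _ le])
    have "?f \<in> borel_measurable lborel" by measurable
    then show "?f \<in> borel_measurable (lebesgue_on {0<..})"
      by (intro measurable_restrict_space1 measurable_completion)
  qed (use I in \<open>auto simp: has_integral_iff\<close>)
  have "shifted_gamma_integral b z n \<le> integral {0<..} ?g"
    unfolding shifted_gamma_integral_def using abs I le
    by (intro integral_le) (auto simp: has_integral_iff set_lebesgue_integral_eq_integral(1) dest!: abs_le_D1)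
  then show "shifted_gamma_integral b z n \<le> (z + 1) powr (b - 1) * (Gamma (real n + 1) + Gamma (real n + b))"
    by (simp only: integral_unique [OF I])
qed

text \<open>Only v in [1, 2] is kept. There z + v lies between z + 1 and 2 (z + 1), and exp (-v) is
  at least exp (-2).\<close>

lemma shifted_gamma_integral_0_ge:
  assumes b: "b > 0" and z: "z \<ge> 0"
  shows "(z + 1) powr (b - 1) * (2 powr (- \<bar>b - 1\<bar>) * exp (- 2)) \<le> shifted_gamma_integral b z 0"
proof -
  let ?f = "\<lambda>v. (z + v) powr (b - 1) * exp (- v) * v ^ 0"
  define c where "c = (z + 1) powr (b - 1) * (2 powr (- \<bar>b - 1\<bar>) * exp (- 2))"
  have int: "?f integrable_on {0<..}"
    by (rule set_lebesgue_integral_eq_integral(1) [OF shifted_gamma_absolutely_integrable(1) [OF b z]])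
  have cont: "?f integrable_on {1..2}"
    using z by (intro integrable_continuous_interval continuous_intros) auto
  have "c \<le> ?f v" if "v \<in> {1..2}" for v
  proof -
    have "(z + 1) powr (b - 1) * 2 powr (- \<bar>b - 1\<bar>) \<le> (z + v) powr (b - 1)"
    proof (cases "b \<ge> 1")
      case True
      have "(z + 1) powr (b - 1) * 2 powr (- \<bar>b - 1\<bar>) \<le> (z + 1) powr (b - 1) * 1"
        using powr_mono [of "- \<bar>b - 1\<bar>" 0 2] by (intro mult_left_mono) auto
      also have "\<dots> \<le> (z + v) powr (b - 1)"
        using True z that by (auto intro!: powr_mono2)
      finally show ?thesis .
    next
      case False
      have "(z + 1) powr (b - 1) * 2 powr (- \<bar>b - 1\<bar>) = ((z + 1) * 2) powr (b - 1)"
        using False z powr_mult [of "z + 1" 2 "b - 1"] by simp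
      also have "\<dots> \<le> (z + v) powr (b - 1)"
        using False z that by (auto intro!: powr_mono2')
      finally show ?thesis .
    qed
    moreover have "exp (- 2) \<le> exp (- v)" using that by simp
    ultimately have "((z + 1) powr (b - 1) * 2 powr (- \<bar>b - 1\<bar>)) * exp (- 2) \<le> (z + v) powr (b - 1) * exp (- v)"
      by (intro mult_mono) auto
    then show ?thesis by (simp add: c_def mult.assoc)
  qed
  then have "integral {1..2} (\<lambda>v::real. c) \<le> integral {1..2} ?f"
    by (intro integral_le cont) auto
  also have "\<dots> \<le> integral {0<..} ?f"
    by (intro integral_subset_le cont int) auto
  finally show ?thesis by (simp add: c_def shifted_gamma_integral_def)
qed

text \<open>The upper and the lower bound share the factor (z + 1)^(b-1), so z drops out of their
  ratio. This is the source of uniformity in x.\<close>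

lemma shifted_gamma_integral_le:
  assumes b: "b > 0"
  shows "\<exists>C>0. \<forall>z\<ge>0. shifted_gamma_integral b z n \<le> C * shifted_gamma_integral b z 0"
proof (intro exI conjI allI impI)
  let ?A = "Gamma (real n + 1) + Gamma (real n + b)" and ?c = "2 powr (- \<bar>b - 1\<bar>) * exp (- 2)"
  have A: "?A > 0" using b by (intro add_pos_pos [of "Gamma _"] Gamma_real_pos add_nonneg_pos) auto
  then show "?A / ?c > 0" by simp
  fix z :: real assume z: "z \<ge> 0"
  have "shifted_gamma_integral b z n \<le> (z + 1) powr (b - 1) * ?A"
    by (rule shifted_gamma_absolutely_integrable(2) [OF b z])
  also have "\<dots> = ?A / ?c * ((z + 1) powr (b - 1) * ?c)" by simp
  also have "\<dots> \<le> ?A / ?c * shifted_gamma_integral b z 0"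
    using A by (intro mult_left_mono shifted_gamma_integral_0_ge b z) simp
  finally show "shifted_gamma_integral b z n \<le> ?A / ?c * shifted_gamma_integral b z 0" .
qed

lemma shifted_gamma_boundary_term_tendsto_0:
  fixes z c :: real
  assumes z: "z \<ge> 0"
  shows "((\<lambda>v. (z + v) powr c * exp (- v) * v ^ n) \<longlongrightarrow> 0) at_top"
proof -
  \<comment> \<open>The real exponent is rounded up to a natural number, negative ones to 0; this
    increases the power once z + v \<ge> 1.\<close>
  define m where "m = nat \<lceil>c\<rceil> + n"
  have lim: "((\<lambda>v::real. exp z * ((z + v) ^ m / exp (z + v))) \<longlongrightarrow> exp z * 0) at_top"
    by (intro tendsto_mult tendsto_const filterlim_compose [OF tendsto_power_div_exp_0]
        filterlim_tendsto_add_at_top [OF tendsto_const] filterlim_ident)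
  show ?thesis
  proof (rule tendsto_sandwich [OF _ _ tendsto_const lim [simplified]])
    show "\<forall>\<^sub>F v in at_top. 0 \<le> (z + v) powr c * exp (- v) * v ^ n"
      using eventually_ge_at_top [of 0] by eventually_elim simp
    show "\<forall>\<^sub>F v in at_top. (z + v) powr c * exp (- v) * v ^ n \<le> exp z * (z + v) ^ m / exp (z + v)"
      using eventually_ge_at_top [of 1]
    proof eventually_elim
      case (elim v)
      have "(z + v) powr c \<le> (z + v) powr real (nat \<lceil>c\<rceil>)"
        using elim z by (intro powr_mono) linarith+
      also have "\<dots> = (z + v) ^ nat \<lceil>c\<rceil>" using elim z by (intro powr_realpow) auto
      finally have "(z + v) powr c * v ^ n \<le> (z + v) ^ nat \<lceil>c\<rceil> * (z + v) ^ n"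
        using elim z by (intro mult_mono power_mono) auto
      then have "(z + v) powr c * v ^ n * exp (- v) \<le> (z + v) ^ m * exp (- v)"
        by (intro mult_right_mono) (auto simp: m_def power_add)
      then show ?case by (simp add: exp_add exp_minus field_simps)
    qed
  qed
qed

text \<open>Integrate the derivative of (z + v)^b exp (-v) v^n, splitting one factor z + v off the
  power. The boundary value at 0 survives only for n = 0 and accounts for the extra term of
  \<open>F_seq\<close> at index 1; the term with the truncated index n - 1 then has coefficient
  0.\<close>

lemma shifted_gamma_integral_by_parts:
  assumes b: "b > 0" and z: "z \<ge> 0"
  shows "shifted_gamma_integral b z (Suc n) =
    (real n + b - z) * shifted_gamma_integral b z n
    + real n * z * shifted_gamma_integral b z (n - 1) + z powr b * 0 ^ n"
proof -
  define W where "W n = (\<lambda>v. (z + v) powr (b - 1) * exp (- v) * v ^ n)" for n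
  have W: "W n absolutely_integrable_on {0<..}" for n
    unfolding W_def by (rule shifted_gamma_absolutely_integrable(1) [OF b z])
  have W': "W n integrable_on {0<..}" for n
    by (rule set_lebesgue_integral_eq_integral(1) [OF W])
  have K: "shifted_gamma_integral b z n = integral {0<..} (W n)" for n
    by (simp add: W_def shifted_gamma_integral_def)
  define F where "F = (\<lambda>v. (z + v) powr b * exp (- v) * v ^ n)"
  define f where "f = (\<lambda>v. (real n + b - z) * W n v + real n * z * W (n - 1) v - W (Suc n) v)"
  have abs: "f absolutely_integrable_on {0<..}"
    unfolding f_def by (intro set_integral_diff set_integral_add set_integrable_mult_right W)
  have DF: "(F has_real_derivative f v) (at v)" if "v > 0" for v
  proof -
    have p: "(z + v) powr b = (z + v) * (z + v) powr (b - 1)"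
      using that z by (simp add: powr_diff)
    have P: "((\<lambda>v. (z + v) powr b) has_real_derivative b * (z + v) powr (b - 1)) (at v)"
      using DERIV_fun_powr [of "\<lambda>v. z + v" 1 v b] that z by (auto intro!: derivative_eq_intros)
    have E: "((\<lambda>v. exp (- v)) has_real_derivative - exp (- v)) (at v)"
      by (auto intro!: derivative_eq_intros)
    have "(F has_real_derivative
       (b * (z + v) powr (b - 1) * exp (- v) + - exp (- v) * (z + v) powr b) * v ^ n
       + (real n * v ^ (n - Suc 0)) * ((z + v) powr b * exp (- v))) (at v)"
      unfolding F_def by (intro DERIV_mult P E DERIV_pow)
    then show ?thesis
      by (rule DERIV_cong) (unfold p, cases n; simp add: f_def W_def algebra_simps)
  qed
  \<comment> \<open>The fundamental theorem used below is stated for \<open>lborel\<close>; Borel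
    measurability of f allows the passage from Lebesgue measure.\<close>
  have leb: "set_integrable lborel {0<..} f"
  proof -
    have [measurable]: "f \<in> borel_measurable borel"
      unfolding f_def W_def by measurable
    show ?thesis using abs unfolding set_integrable_def
      by (subst (asm) integrable_completion) auto
  qed
  have "(LBINT v=ereal 0..\<infinity>. f v) = 0 - z powr b * 0 ^ n"
  proof (rule interval_integral_FTC_integrable)
    show "(F has_vector_derivative f v) (at v)" if "ereal 0 < ereal v" for v
      using DF [of v] that by (simp add: has_real_derivative_iff_has_vector_derivative)
    show "isCont f v" if "ereal 0 < ereal v" for v
      unfolding f_def W_def using that z by (intro continuous_intros) auto
    show "set_integrable lborel (einterval (ereal 0) \<infinity>) f"
      using leb by (simp add: greaterThan_def)
    \<comment> \<open>For z = 0 the base tends to 0, and b > 0 still gives the limit.\<close>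
    have P: "((\<lambda>v. (z + v) powr b) \<longlongrightarrow> (z + 0) powr b) (at_right 0)"
      using b z by (intro tendsto_powr' tendsto_intros disjI2 conjI)
        (auto intro!: eventually_at_rightI [of 0 1])
    have "(F \<longlongrightarrow> (z + 0) powr b * exp (- 0) * 0 ^ n) (at_right 0)"
      unfolding F_def by (rule tendsto_mult [OF tendsto_mult [OF P]]; intro tendsto_intros)
    then have "(F \<longlongrightarrow> z powr b * 0 ^ n) (at_right 0)" by simp
    then show "((F \<circ> real_of_ereal) \<longlongrightarrow> z powr b * 0 ^ n) (at_right (ereal 0))"
      by (simp add: at_right_ereal o_def filterlim_filtermap)
    have "(F \<longlongrightarrow> 0) at_top"
      unfolding F_def by (rule shifted_gamma_boundary_term_tendsto_0 [OF z])
    then show "((F \<circ> real_of_ereal) \<longlongrightarrow> 0) (at_left \<infinity>)"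
      by (simp add: at_left_PInf o_def filterlim_filtermap)
  qed auto
  then have "integral {0<..} f = - (z powr b * 0 ^ n)"
    using set_borel_integral_eq_integral(2) [OF leb]
    by (simp add: interval_lebesgue_integral_def greaterThan_def)
  moreover have "integral {0<..} f = (real n + b - z) * shifted_gamma_integral b z n
    + real n * z * shifted_gamma_integral b z (n - 1) - shifted_gamma_integral b z (Suc n)"
    unfolding f_def K
    by (subst integral_diff integral_add, (intro integrable_add integrable_on_mult_right W')+)+ simp
  ultimately show ?thesis by simp
qed

section \<open>The uniform expansion\<close>

lemma upper_inc_Gamma_shift:
  assumes b: "b > 0" and z: "z \<ge> 0"
  shows "upper_inc_Gamma b z = exp (- z) * shifted_gamma_integral b z 0"
proof -
  let ?f = "\<lambda>t. t powr (b - 1) * exp (- t)"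
  have img: "(\<lambda>v. z + v) ` {0<..} = {z<..}"
  proof -
    have "t \<in> (\<lambda>v. z + v) ` {0<..}" if "t > z" for t
      using that by (intro image_eqI [of _ _ "t - z"]) auto
    then show ?thesis by auto
  qed
  have eq: "(\<lambda>v. \<bar>1\<bar> * ?f (z + v)) = (\<lambda>v. exp (- z) * ((z + v) powr (b - 1) * exp (- v) * v ^ 0))"
    by (auto simp: exp_diff exp_minus field_simps)
  have abs: "(\<lambda>v. \<bar>1\<bar> * ?f (z + v)) absolutely_integrable_on {0<..}"
    unfolding eq by (intro set_integrable_mult_right shifted_gamma_absolutely_integrable(1) b z)
  have deriv: "((\<lambda>v. z + v) has_real_derivative 1) (at v within {0<..})" for v
    by (auto intro!: derivative_eq_intros)
  have "upper_inc_Gamma b z = integral {z<..} ?f"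
    unfolding upper_inc_Gamma_def
    by (rule integral_spike_set) (auto intro!: negligible_subset [OF negligible_sing [of z]])
  also have "\<dots> = integral {0<..} (\<lambda>v. \<bar>1\<bar> * ?f (z + v))"
    using has_absolute_integral_change_of_variables_1' [of "{0<..}" "\<lambda>v. z + v" "\<lambda>_. 1" ?f
        "integral {0<..} (\<lambda>v. \<bar>1\<bar> * ?f (z + v))"] abs deriv
    unfolding img by auto
  also have "\<dots> = exp (- z) * shifted_gamma_integral b z 0"
    unfolding eq by (simp add: shifted_gamma_integral_def)
  finally show ?thesis .
qed

text \<open>Dividing integration by parts at z = a \<xi> by the appropriate power of a reproduces
  the defining recurrence, and the translation t = z + v settles index 0.\<close>

lemma F_seq_eq:
  assumes a: "a > 0" and b: "b > 0" and \<xi>: "\<xi> \<ge> 0"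
  shows "F_seq \<xi> a b n =
    exp (- a * \<xi>) * a powr (- b) / Gamma b * (shifted_gamma_integral b (a * \<xi>) n / a ^ n)"
proof -
  let ?K = "shifted_gamma_integral b (a * \<xi>)"
  have z: "a * \<xi> \<ge> 0" using a \<xi> by simp
  have G: "Gamma b > 0" using b by (rule Gamma_real_pos)
  have F0: "F_seq \<xi> a b 0 = exp (- a * \<xi>) * a powr (- b) / Gamma b * (?K 0 / a ^ 0)"
    by (simp add: reg_upper_inc_Gamma_def upper_inc_Gamma_shift [OF b z])
  \<comment> \<open>This converts the boundary term (a \<xi>)^b into the \<xi>^b of F_1, also when
    \<xi> = 0.\<close>
  have p: "a powr (- b) * (a * \<xi>) powr b = \<xi> powr b"
    using a \<xi> by (simp add: powr_mult powr_minus)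
  show ?thesis
  proof (induction n rule: induct_nat_012)
    case 0
    show ?case by (rule F0)
  next
    case 1
    have K: "?K (Suc 0) = (b - a * \<xi>) * ?K 0 + (a * \<xi>) powr b"
      using shifted_gamma_integral_by_parts [OF b z, of 0] by simp
    have "exp (- a * \<xi>) * a powr (- b) / Gamma b * (?K (Suc 0) / a ^ Suc 0) =
      (b - a * \<xi>) / a * (exp (- a * \<xi>) * a powr (- b) / Gamma b * ?K 0)
      + (a powr (- b) * (a * \<xi>) powr b) * exp (- a * \<xi>) / (a * Gamma b)"
      unfolding K using a G by (simp add: field_simps)
    then show ?case unfolding p using F0 by simp
  next
    case (ge2 n)
    have K: "?K (Suc (Suc n)) = (real (Suc n) + b - a * \<xi>) * ?K (Suc n) + real (Suc n) * (a * \<xi>) * ?K n"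
      using shifted_gamma_integral_by_parts [OF b z, of "Suc n"] by simp
    show ?case unfolding F_seq.simps(3) ge2 K using a G by (simp add: field_simps)
  qed
qed

text \<open>The map v -> exp (-(\<xi> + v / a)) carries (0, \<infinity>) onto (0, x). With y = \<xi>
  + v / a, the power t^a gives exp (-a \<xi>) exp (-v), dt / t gives 1 / a up to sign, and 1 - t = y
  \<open>exp_quot y\<close>.\<close>

lemma reg_inc_beta_transform:
  assumes a: "a > 0" and b: "b > 0" and x: "x \<in> {0<..1}"
  defines "\<xi> \<equiv> - ln x"
  shows "(\<lambda>v. (a * \<xi> + v) powr (b - 1) * exp (- v) * exp_quot (\<xi> + v / a) powr (b - 1))
      absolutely_integrable_on {0<..}" (is "?h absolutely_integrable_on _")
    and "Gamma a / Gamma (a + b) * reg_inc_beta x a b =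
      exp (- a * \<xi>) * a powr (- b) / Gamma b *
      integral {0<..} (\<lambda>v. (a * \<xi> + v) powr (b - 1) * exp (- v) * exp_quot (\<xi> + v / a) powr (b - 1))"
proof -
  let ?f = "\<lambda>t. t powr (a - 1) * (1 - t) powr (b - 1)"
  define g where "g = (\<lambda>v. exp (- (\<xi> + v / a)))"
  define c where "c = exp (- a * \<xi>) * a powr (- b)"
  have c: "c \<noteq> 0" using a by (simp add: c_def)
  have \<xi>: "\<xi> \<ge> 0" "exp (- \<xi>) = x" using x by (auto simp: \<xi>_def)
  have img: "g ` {0<..} = {0<..<x}"
  proof safe
    fix v :: real assume "v > 0"
    then have "g v < exp (- \<xi>)" using a by (simp add: g_def)
    then show "g v \<in> {0<..<x}" using \<xi> by (simp add: g_def)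
  next
    fix t assume t: "t \<in> {0<..<x}"
    then have "ln t < ln x" by simp
    then have "a * (- ln t - \<xi>) > 0" using a by (simp add: \<xi>_def)
    moreover have "t = g (a * (- ln t - \<xi>))" using a t by (simp add: g_def)
    ultimately show "t \<in> g ` {0<..}" by blast
  qed
  have inj: "inj_on g {0<..}" using a by (auto simp: inj_on_def g_def)
  have deriv: "(g has_field_derivative - g v / a) (at v within {0<..})" for v
    unfolding g_def using a by (auto intro!: derivative_eq_intros)
  have eq: "\<bar>- g v / a\<bar> * ?f (g v) = c * ?h v" if "v > 0" for v
  proof -
    have y: "\<xi> + v / a > 0" using a \<xi> that by (simp add: add_nonneg_pos)
    have av: "a * \<xi> + v = a * (\<xi> + v / a)" using a by (simp add: field_simps)
    have y': "1 - g v = (\<xi> + v / a) * exp_quot (\<xi> + v / a)"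
      using y by (simp add: exp_quot_def g_def)
    have ga: "g v powr a = exp (- a * \<xi>) * exp (- v)"
      using a by (simp add: g_def powr_def field_simps flip: exp_add)
    \<comment> \<open>The factor a^(b-1) combines with (\<xi> + v / a)^(b-1) into (a \<xi> +
      v)^(b-1).\<close>
    have pa: "1 / a = a powr (- b) * a powr (b - 1)"
      using a by (subst powr_add [symmetric]) (simp add: powr_neg_one)
    have "\<bar>- g v / a\<bar> * ?f (g v) = g v powr a * (1 / a) * (1 - g v) powr (b - 1)"
      using a by (simp add: powr_diff g_def)
    also have "\<dots> = c * ?h v"
      unfolding y' ga pa av using a y exp_quot_pos [of "\<xi> + v / a"]
      by (simp add: c_def powr_mult)
    finally show ?thesis .
  qed
  \<comment> \<open>Integrability is known on the beta side; the change of variables carries it over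
    to the integrand in v.\<close>
  have "set_integrable lborel {0..1} ?f"
    using integrable_Beta a b by blast
  then have "?f absolutely_integrable_on {0..1}"
    unfolding set_integrable_def by (rule integrable_completion [THEN iffD2, rotated]) auto
  then have "?f absolutely_integrable_on {0<..<x}"
    by (rule set_integrable_subset) (use x in auto)
  then have *: "(\<lambda>v. \<bar>- g v / a\<bar> * ?f (g v)) absolutely_integrable_on {0<..} \<and>
      integral {0<..} (\<lambda>v. \<bar>- g v / a\<bar> * ?f (g v)) = integral {0<..<x} ?f"
    using has_absolute_integral_change_of_variables_1' [of "{0<..}" g "\<lambda>v. - g v / a" ?f
        "integral {0<..<x} ?f"] deriv inj unfolding img by auto
  have "(\<lambda>v. c * ?h v) absolutely_integrable_on {0<..}"
    using * eq by (subst set_integrable_cong [OF refl refl, of _ _ "\<lambda>v. \<bar>- g v / a\<bar> * ?f (g v)"]) auto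
  then have "(\<lambda>v. inverse c * (c * ?h v)) absolutely_integrable_on {0<..}"
    by (rule set_integrable_mult_right)
  then show "?h absolutely_integrable_on {0<..}"
    using c by (simp flip: mult.assoc)
  have "integral {0..x} ?f = integral {0<..<x} ?f"
    by (rule integral_spike_set) (auto intro!: negligible_subset [OF negligible_finite [of "{0, x}"]])
  also have "\<dots> = integral {0<..} (\<lambda>v. c * ?h v)"
    unfolding conjunct2 [OF *, symmetric] by (rule integral_cong) (use eq in auto)
  also have "\<dots> = c * integral {0<..} ?h" by simp
  finally have "integral {0..x} ?f = c * integral {0<..} ?h" .
  moreover have "Gamma a > 0" "Gamma b > 0" "Gamma (a + b) > 0"
    using a b by (auto intro: Gamma_real_pos)
  ultimately show "Gamma a / Gamma (a + b) * reg_inc_beta x a b =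
      exp (- a * \<xi>) * a powr (- b) / Gamma b * integral {0<..} ?h"
    by (simp add: reg_inc_beta_def Beta_def c_def)
qed

text \<open>Integrating the Taylor estimate at u = v / a against the weight bounds the error by a
  multiple of F_N, which the comparison of shifted gamma integrals turns into a^(-N) F_0. The
  estimate holds for every a > 0.\<close>

lemma reg_inc_beta_expansion:
  assumes b: "b > 0" and N: "N > 0"
  shows "\<exists>C>0. \<forall>a>0. \<forall>x\<in>{0<..1}.
    \<bar>Gamma a / Gamma (a + b) * reg_inc_beta x a b
       - (\<Sum>n<N. d_coeff (- ln x) b n * F_seq (- ln x) a b n)\<bar>
    \<le> C * a powr (- real N) * F_seq (- ln x) a b 0"
proof -
  obtain M where M: "M \<ge> 0" and Taylor: "\<And>\<xi> u. \<xi> \<ge> 0 \<Longrightarrow> u > 0 \<Longrightarrow>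
    \<bar>exp_quot (\<xi> + u) powr (b - 1) - (\<Sum>n<N. d_coeff \<xi> b n * u ^ n)\<bar> \<le> M * u ^ N"
    using exp_quot_power_Taylor_bound [OF b N] by blast
  obtain D where D: "D > 0" "\<And>z. z \<ge> 0 \<Longrightarrow> shifted_gamma_integral b z N \<le> D * shifted_gamma_integral b z 0"
    using shifted_gamma_integral_le [OF b] by blast
  show ?thesis
  proof (intro exI conjI allI impI ballI)
    \<comment> \<open>M may be 0, so M + 1 is taken to make the constant strictly positive.\<close>
    show "(M + 1) * D > 0" using M D by simp
    fix a x :: real assume a: "a > 0" and x: "x \<in> {0<..1}"
    define \<xi> where "\<xi> = - ln x"
    have \<xi>: "\<xi> \<ge> 0" using x by (simp add: \<xi>_def)
    have z: "a * \<xi> \<ge> 0" using a \<xi> by simp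
    let ?K = "shifted_gamma_integral b (a * \<xi>)"
    define W where "W n = (\<lambda>v. (a * \<xi> + v) powr (b - 1) * exp (- v) * v ^ n)" for n
    have W: "W n integrable_on {0<..}" for n
      unfolding W_def
      by (rule set_lebesgue_integral_eq_integral(1) [OF shifted_gamma_absolutely_integrable(1) [OF b z]])
    have K: "?K n = integral {0<..} (W n)" for n
      by (simp add: W_def shifted_gamma_integral_def)
    define h where "h = (\<lambda>v. (a * \<xi> + v) powr (b - 1) * exp (- v) * exp_quot (\<xi> + v / a) powr (b - 1))"
    \<comment> \<open>This is the weight \<open>W 0\<close> times the Taylor polynomial at u = v /
      a, so its integral yields the partial sum of the expansion.\<close>
    define T where "T = (\<lambda>v. \<Sum>n<N. (d_coeff \<xi> b n / a ^ n) * W n v)"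
    define c where "c = exp (- a * \<xi>) * a powr (- b) / Gamma b"
    have c: "c > 0" using a b by (simp add: c_def Gamma_real_pos)
    have h: "h integrable_on {0<..}"
      unfolding h_def \<xi>_def
      by (rule set_lebesgue_integral_eq_integral(1) [OF reg_inc_beta_transform(1) [OF a b x]])
    have TW: "(\<lambda>v. d_coeff \<xi> b n / a ^ n * W n v) integrable_on {0<..}" for n
      by (intro integrable_on_mult_right W)
    have T: "T integrable_on {0<..}"
      unfolding T_def by (intro integrable_sum TW finite_lessThan)
    have T_eq: "integral {0<..} T = (\<Sum>n<N. d_coeff \<xi> b n / a ^ n * ?K n)"
      unfolding T_def K by (subst integral_sum [OF finite_lessThan TW]) simp
    have le: "norm (h v - T v) \<le> M / a ^ N * W N v" if "v \<in> {0<..}" for v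
    proof -
      have "h v - T v = W 0 v * (exp_quot (\<xi> + v / a) powr (b - 1) - (\<Sum>n<N. d_coeff \<xi> b n * (v / a) ^ n))"
        by (simp add: h_def T_def W_def right_diff_distrib sum_distrib_left power_divide mult_ac)
      then have "norm (h v - T v) =
        W 0 v * \<bar>exp_quot (\<xi> + v / a) powr (b - 1) - (\<Sum>n<N. d_coeff \<xi> b n * (v / a) ^ n)\<bar>"
        by (simp add: abs_mult W_def)
      also have "\<dots> \<le> W 0 v * (M * (v / a) ^ N)"
        using a that \<xi> by (intro mult_left_mono Taylor) (auto simp: W_def)
      also have "\<dots> = M / a ^ N * W N v" by (simp add: W_def power_divide)
      finally show ?thesis .
    qed
    have "\<bar>integral {0<..} h - integral {0<..} T\<bar> = norm (integral {0<..} (\<lambda>v. h v - T v))"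
      using h T by (simp add: integral_diff)
    also have "\<dots> \<le> integral {0<..} (\<lambda>v. M / a ^ N * W N v)"
      by (intro integral_norm_bound_integral integrable_diff h T integrable_on_mult_right W le)
    also have "\<dots> = M / a ^ N * ?K N" by (simp add: K)
    also have "\<dots> \<le> M / a ^ N * (D * ?K 0)"
      using M a D z by (intro mult_left_mono) auto
    also have "\<dots> \<le> (M + 1) / a ^ N * (D * ?K 0)"
    proof -
      have "?K 0 \<ge> 0"
        by (rule order_trans [OF _ shifted_gamma_integral_0_ge [OF b z]]) simp
      then show ?thesis using a D by (intro mult_right_mono divide_right_mono) auto
    qed
    finally have main: "\<bar>integral {0<..} h - integral {0<..} T\<bar> \<le> (M + 1) / a ^ N * (D * ?K 0)" .
    have "Gamma a / Gamma (a + b) * reg_inc_beta x a b = c * integral {0<..} h"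
      using reg_inc_beta_transform(2) [OF a b x] by (simp add: c_def h_def \<xi>_def)
    moreover have "(\<Sum>n<N. d_coeff \<xi> b n * F_seq \<xi> a b n) = c * integral {0<..} T"
      unfolding T_eq sum_distrib_left F_seq_eq [OF a b \<xi>] c_def [symmetric]
      by (intro sum.cong) (auto simp: field_simps)
    ultimately have "\<bar>Gamma a / Gamma (a + b) * reg_inc_beta x a b
       - (\<Sum>n<N. d_coeff \<xi> b n * F_seq \<xi> a b n)\<bar> = c * \<bar>integral {0<..} h - integral {0<..} T\<bar>"
      using c by (simp add: abs_mult flip: right_diff_distrib)
    also have "\<dots> \<le> c * ((M + 1) / a ^ N * (D * ?K 0))"
      using main c by (intro mult_left_mono) auto
    also have "\<dots> = (M + 1) * D * a powr (- real N) * F_seq \<xi> a b 0"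
      unfolding F_seq_eq [OF a b \<xi>] c_def [symmetric]
      using a by (simp add: powr_minus_divide powr_realpow)
    finally show "\<bar>Gamma a / Gamma (a + b) * reg_inc_beta x a b
       - (\<Sum>n<N. d_coeff (- ln x) b n * F_seq (- ln x) a b n)\<bar>
      \<le> (M + 1) * D * a powr (- real N) * F_seq (- ln x) a b 0"
      unfolding \<xi>_def .
  qed
qed

theorem theorem1:
  fixes b :: real
  assumes b_pos: "b > 0"
  shows
    "(\<forall>N::nat. N \<ge> 1 \<longrightarrow>
       (\<exists>C>0. \<exists>a0>0. \<forall>a\<ge>a0. \<forall>x\<in>{0<..1}.
          let \<xi> = - ln x in
          \<bar>Gamma a / Gamma (a + b) * reg_inc_beta x a b
             - (\<Sum>n<N. d_coeff \<xi> b n * F_seq \<xi> a b n)\<bar>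
          \<le> C * a powr (- real N) * F_seq \<xi> a b 0))
     \<and> (\<forall>x\<in>{0<..<1}.
          let \<xi> = - ln x in
          d_coeff \<xi> b 0 = ((1 - x) / \<xi>) powr (b - 1) \<and>
          d_coeff \<xi> b 1 = (x * \<xi> + x - 1) / ((1 - x) * \<xi>) * (b - 1) * d_coeff \<xi> b 0)
     \<and> ((\<lambda>x::real. ((1 - x) / (- ln x)) powr (b - 1)) \<longlongrightarrow> d_coeff 0 b 0) (at_left 1)
     \<and> ((\<lambda>x::real. (x * (- ln x) + x - 1) / ((1 - x) * (- ln x)) * (b - 1) * d_coeff (- ln x) b 0)
          \<longlongrightarrow> d_coeff 0 b 1) (at_left 1)
     \<and> (b \<noteq> 1 \<longrightarrow> (\<forall>x\<in>{0<..1}. \<forall>n::nat.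
          let \<xi> = - ln x; d = d_coeff \<xi> b in
          \<xi> * (real n + 1) * (real n + 2) * d 0 * d (n + 2) =
            \<xi> * (\<Sum>m=0..n. (real m + 1)
                   * (real n - 2 * real m + 1 + (real m - real n - 1) / (b - 1))
                   * d (m + 1) * d (n - m + 1))
            + (\<Sum>m=0..n. (real m + 1)
                   * (real n - 2 * real m - 2 - \<xi> + (real m - real n) / (b - 1))
                   * d (m + 1) * d (n - m))
            + (\<Sum>m=0..n. (1 - real m - b) * d m * d (n - m))))
     \<and> (b = 1 \<longrightarrow> (\<forall>x\<in>{0<..1}.
          d_coeff (- ln x) b 0 = 1 \<and> (\<forall>n\<ge>1. d_coeff (- ln x) b n = 0)))"
proof (intro conjI)
  show "\<forall>N::nat. N \<ge> 1 \<longrightarrow>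
       (\<exists>C>0. \<exists>a0>0. \<forall>a\<ge>a0. \<forall>x\<in>{0<..1}.
          let \<xi> = - ln x in
          \<bar>Gamma a / Gamma (a + b) * reg_inc_beta x a b
             - (\<Sum>n<N. d_coeff \<xi> b n * F_seq \<xi> a b n)\<bar>
          \<le> C * a powr (- real N) * F_seq \<xi> a b 0)"
  proof (intro allI impI)
    fix N :: nat assume "N \<ge> 1"
    then obtain C where C: "C > 0" "\<And>a x. a > 0 \<Longrightarrow> x \<in> {0<..1} \<Longrightarrow>
      \<bar>Gamma a / Gamma (a + b) * reg_inc_beta x a b
       - (\<Sum>n<N. d_coeff (- ln x) b n * F_seq (- ln x) a b n)\<bar>
      \<le> C * a powr (- real N) * F_seq (- ln x) a b 0"
      using reg_inc_beta_expansion [OF b_pos, of N] by auto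
    show "\<exists>C>0. \<exists>a0>0. \<forall>a\<ge>a0. \<forall>x\<in>{0<..1}.
          let \<xi> = - ln x in
          \<bar>Gamma a / Gamma (a + b) * reg_inc_beta x a b
             - (\<Sum>n<N. d_coeff \<xi> b n * F_seq \<xi> a b n)\<bar>
          \<le> C * a powr (- real N) * F_seq \<xi> a b 0"
      \<comment> \<open>The bound holds for all a > 0, so any positive threshold would do; 1 is
        chosen.\<close>
      unfolding Let_def using C by (intro exI [of _ C] exI [of _ 1] conjI) auto
  qed
  have d0: "d_coeff (- ln x) b 0 = ((1 - x) / (- ln x)) powr (b - 1)"
    and d1: "d_coeff (- ln x) b 1 =
      (x * (- ln x) + x - 1) / ((1 - x) * (- ln x)) * (b - 1) * d_coeff (- ln x) b 0"
    if "x \<in> {0<..<1}" for x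
  proof -
    have x: "ln x \<noteq> 0" "exp (- (- ln x)) = x" using that by auto
    then show "d_coeff (- ln x) b 0 = ((1 - x) / (- ln x)) powr (b - 1)"
      by (simp add: d_coeff_0 exp_quot_def)
    show "d_coeff (- ln x) b 1 =
      (x * (- ln x) + x - 1) / ((1 - x) * (- ln x)) * (b - 1) * d_coeff (- ln x) b 0"
      using d_coeff_1 [of "- ln x" b] x by (simp only: mult.commute [of "- ln x" x])
  qed
  show "\<forall>x\<in>{0<..<1}.
          let \<xi> = - ln x in
          d_coeff \<xi> b 0 = ((1 - x) / \<xi>) powr (b - 1) \<and>
          d_coeff \<xi> b 1 = (x * \<xi> + x - 1) / ((1 - x) * \<xi>) * (b - 1) * d_coeff \<xi> b 0"
    unfolding Let_def using d0 d1 by blast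
  \<comment> \<open>Near 1 from the left the closed forms coincide with the coefficients at -ln x,
    so both limits reduce to continuity of the coefficients.\<close>
  have ev: "\<forall>\<^sub>F x in at_left 1. x \<in> {0<..<1::real}"
    by (rule eventually_at_leftI [of 0]) auto
  show "((\<lambda>x::real. ((1 - x) / (- ln x)) powr (b - 1)) \<longlongrightarrow> d_coeff 0 b 0) (at_left 1)"
    using d_coeff_tendsto_at_left_1 by (rule Lim_transform_eventually) (use ev d0 in \<open>auto elim!: eventually_mono\<close>)
  show "((\<lambda>x::real. (x * (- ln x) + x - 1) / ((1 - x) * (- ln x)) * (b - 1) * d_coeff (- ln x) b 0)
          \<longlongrightarrow> d_coeff 0 b 1) (at_left 1)"
    using d_coeff_tendsto_at_left_1 by (rule Lim_transform_eventually) (rule eventually_mono [OF ev], rule d1)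
  show "b \<noteq> 1 \<longrightarrow> (\<forall>x\<in>{0<..1}. \<forall>n::nat.
          let \<xi> = - ln x; d = d_coeff \<xi> b in
          \<xi> * (real n + 1) * (real n + 2) * d 0 * d (n + 2) =
            \<xi> * (\<Sum>m=0..n. (real m + 1)
                   * (real n - 2 * real m + 1 + (real m - real n - 1) / (b - 1))
                   * d (m + 1) * d (n - m + 1))
            + (\<Sum>m=0..n. (real m + 1)
                   * (real n - 2 * real m - 2 - \<xi> + (real m - real n) / (b - 1))
                   * d (m + 1) * d (n - m))
            + (\<Sum>m=0..n. (1 - real m - b) * d m * d (n - m)))"
    unfolding Let_def using d_coeff_recurrence by blast
  show "b = 1 \<longrightarrow> (\<forall>x\<in>{0<..1}.
          d_coeff (- ln x) b 0 = 1 \<and> (\<forall>n\<ge>1. d_coeff (- ln x) b n = 0))"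
    by (simp add: d_coeff_at_1)
qed

end
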